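(* For every finite simple graph $G$, the edge-biclique hypergraph $\mathcal{EB}(G)$ is equal to the clique hypergraph $\mathcal{K}(L_G)$ of the biclique line graph $L_G$ if and only if $G$ contains no induced subgraph isomorphic to the triangular prism.
   Context: Graphs are finite and simple. A biclique of $G$ is a vertex set $B\subseteq V(G)$ such that $G[B]$ is a complete bipartite graph and $B$ is inclusion-wise maximal with this property. A clique of a graph is an inclusion-wise maximal vertex set inducing a complete graph. The edge-biclique hypergraph $\mathcal{EB}(G)$ has vertex set $E(G)$ and its hyperedges are the edge sets $E(G[B])$ of the bicliques $B$ of $G$. The biclique line graph $L_G$ is the graph with vertex set $E(G)$ in which two edges of $G$ are adjacent iff they both are edges of $G[B]$ for some common biclique $B$ of $G$ (i.e. $L_G$ is the 2-section of $\mathcal{EB}(G)$). The clique hypergraph $\mathcal{K}(H)$ of a graph $H$ has vertex set $V(H)$ and the cliques of $H$ as hyperedges. The triangular prism is the graph on vertices $a,b,c,d,e,f$ consisting of the triangles $abc$ and $def$ together with the edges $ad,be,cf$. *)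

theory Defs
  imports Main
begin

text \<open>
  A graph or a hypergraph is a pair of a vertex set and a set of (hyper)edges, where each
  (hyper)edge is a set of vertices. Undirected edges are two-element sets, so a graph whose
  vertices are the edges of a graph on \<open>'a\<close> is a graph on \<open>'a set\<close>.
\<close>

type_synonym 'a hypergraph = "'a set \<times> 'a set set"

abbreviation verts :: "'a hypergraph \<Rightarrow> 'a set" where
  "verts G \<equiv> fst G"

abbreviation edges :: "'a hypergraph \<Rightarrow> 'a set set" where
  "edges G \<equiv> snd G"

definition finite_simple_graph :: "'a hypergraph \<Rightarrow> bool" where
  "finite_simple_graph G \<longleftrightarrow>
     finite (verts G) \<and> (\<forall>e\<in>edges G. e \<subseteq> verts G \<and> card e = 2)"

definition induced_subgraph :: "'a hypergraph \<Rightarrow> 'a set \<Rightarrow> 'a hypergraph" where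
  "induced_subgraph G S = (S, {e \<in> edges G. e \<subseteq> S})"

definition graph_isomorphic :: "'a hypergraph \<Rightarrow> 'b hypergraph \<Rightarrow> bool" where
  "graph_isomorphic G H \<longleftrightarrow>
     (\<exists>f. bij_betw f (verts G) (verts H) \<and> edges H = (\<lambda>e. f ` e) ` edges G)"

text \<open>
  The graph without vertices does not count as complete, and both sides of a complete bipartite
  graph are nonempty. So an edgeless graph has no bicliques, isolated vertices do not
  contribute an empty hyperedge, and the graph without vertices has no cliques.
\<close>

definition complete_graph :: "'a hypergraph \<Rightarrow> bool" where
  "complete_graph G \<longleftrightarrow>
     verts G \<noteq> {} \<and> edges G = {e. e \<subseteq> verts G \<and> card e = 2}"

definition complete_bipartite_graph :: "'a hypergraph \<Rightarrow> bool" where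
  "complete_bipartite_graph G \<longleftrightarrow>
     (\<exists>X Y. X \<noteq> {} \<and> Y \<noteq> {} \<and> X \<inter> Y = {} \<and> verts G = X \<union> Y \<and>
        edges G = {{x, y} | x y. x \<in> X \<and> y \<in> Y})"

definition is_clique :: "'a hypergraph \<Rightarrow> 'a set \<Rightarrow> bool" where
  "is_clique G C \<longleftrightarrow>
     C \<subseteq> verts G \<and> complete_graph (induced_subgraph G C) \<and>
     (\<forall>C'. C \<subseteq> C' \<and> C' \<subseteq> verts G \<and> complete_graph (induced_subgraph G C') \<longrightarrow> C' = C)"

definition is_biclique :: "'a hypergraph \<Rightarrow> 'a set \<Rightarrow> bool" where
  "is_biclique G B \<longleftrightarrow>
     B \<subseteq> verts G \<and> complete_bipartite_graph (induced_subgraph G B) \<and>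
     (\<forall>B'. B \<subseteq> B' \<and> B' \<subseteq> verts G \<and> complete_bipartite_graph (induced_subgraph G B')
        \<longrightarrow> B' = B)"

definition clique_hypergraph :: "'a hypergraph \<Rightarrow> 'a hypergraph" where
  "clique_hypergraph G = (verts G, {C. is_clique G C})"

definition edge_biclique_hypergraph :: "'a hypergraph \<Rightarrow> 'a set hypergraph" where
  "edge_biclique_hypergraph G =
     (edges G, {edges (induced_subgraph G B) | B. is_biclique G B})"

definition biclique_line_graph :: "'a hypergraph \<Rightarrow> 'a set hypergraph" where
  "biclique_line_graph G =
     (edges G,
      {{e, e'} | e e'. e \<in> edges G \<and> e' \<in> edges G \<and> e \<noteq> e' \<and>
         (\<exists>B. is_biclique G B \<and> e \<in> edges (induced_subgraph G B) \<and>
              e' \<in> edges (induced_subgraph G B))})"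

definition triangular_prism :: "nat hypergraph" where
  "triangular_prism =
     ({0, 1, 2, 3, 4, 5},
      {{0, 1}, {1, 2}, {0, 2}, {3, 4}, {4, 5}, {3, 5}, {0, 3}, {1, 4}, {2, 5}})"

end

theory Submission
  imports Defs
begin

text \<open>
  Two edges of \<open>G\<close> are adjacent in the biclique line graph iff their endpoints together induce a
  complete bipartite graph. The three rungs of an induced prism are therefore pairwise adjacent,
  but no biclique contains the triangles they span. Conversely, let \<open>C\<close> be a set of pairwise
  adjacent edges and fix \<open>uv \<in> C\<close>. Every vertex covered by \<open>C\<close> is adjacent to exactly one of \<open>u\<close>
  and \<open>v\<close>, which splits the covered vertices into two sides, and every edge in \<open>C\<close> joins the two
  sides. If this splitting is not complete bipartite, then the failure is witnessed by two disjoint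
  edges \<open>wp\<close>, \<open>w'p'\<close> in \<open>C\<close> with \<open>w\<close>, \<open>w'\<close> on the same side and adjacent, and \<open>uv\<close>, \<open>wp\<close>, \<open>w'p'\<close>
  are the rungs of an induced prism. So in a prism-free graph \<open>C\<close> lies in a biclique.
\<close>

section \<open>Complete bipartite vertex sets and their extension to bicliques\<close>

lemma finite_maximal_superset:
  assumes "finite V" "S \<subseteq> V" "P S"
  obtains B where "S \<subseteq> B" "B \<subseteq> V" "P B" "\<forall>B'. B \<subseteq> B' \<and> B' \<subseteq> V \<and> P B' \<longrightarrow> B' = B"
proof -
  have "finite {B. B \<subseteq> V \<and> P B}"
    using assms(1) by simp
  moreover have "S \<in> {B. B \<subseteq> V \<and> P B}"
    using assms by simp
  ultimately obtain B where "B \<in> {B. B \<subseteq> V \<and> P B}" "S \<subseteq> B"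
    "\<forall>B' \<in> {B. B \<subseteq> V \<and> P B}. B \<subseteq> B' \<longrightarrow> B = B'"
    using finite_has_maximal2[of "{B. B \<subseteq> V \<and> P B}" S] by blast
  then show thesis
    by (intro that[of B]) auto
qed

text \<open>One side \<open>X\<close> encodes the whole bipartition: only its trace on
  \<open>S\<close> matters, and the other side is \<open>S - X\<close>. Either side may be empty, so
  that the property passes to all subsets of \<open>S\<close>.\<close>

definition splits :: "'a hypergraph \<Rightarrow> 'a set \<Rightarrow> 'a set \<Rightarrow> bool" where
  "splits G X S \<longleftrightarrow> (\<forall>x\<in>S. \<forall>y\<in>S. {x, y} \<in> edges G \<longleftrightarrow> (x \<in> X) \<noteq> (y \<in> X))"

lemma splitsD:
  "splits G X S \<Longrightarrow> x \<in> S \<Longrightarrow> y \<in> S \<Longrightarrow> {x, y} \<in> edges G \<longleftrightarrow> (x \<in> X) \<noteq> (y \<in> X)"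
  by (simp add: splits_def)

lemma splits_subset: "splits G X S \<Longrightarrow> T \<subseteq> S \<Longrightarrow> splits G X T"
  by (auto simp: splits_def)

lemma simple_edgeE:
  assumes "finite_simple_graph G" "e \<in> edges G"
  obtains x y where "e = {x, y}" "x \<noteq> y" "x \<in> verts G" "y \<in> verts G"
  using assms unfolding finite_simple_graph_def card_2_iff by (metis insert_subset)

lemma simple_no_loop: "finite_simple_graph G \<Longrightarrow> {x, x} \<notin> edges G"
  by (auto simp: finite_simple_graph_def)

lemma edge_splits:
  assumes "finite_simple_graph G" "{x, y} \<in> edges G"
  shows "splits G {x} {x, y}"
  using assms simple_no_loop[OF assms(1)]
  by (auto simp: splits_def insert_commute)

text \<open>The sides are \<open>S \<inter> X\<close> and \<open>S - X\<close>. The ends of an edge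
  inside \<open>S\<close> lie on different sides, so one such edge is exactly what makes both sides
  nonempty.\<close>

lemma complete_bipartite_induced_iff:
  assumes G: "finite_simple_graph G"
  shows "complete_bipartite_graph (induced_subgraph G S) \<longleftrightarrow>
    (\<exists>X. splits G X S) \<and> (\<exists>e\<in>edges G. e \<subseteq> S)"
proof
  assume "complete_bipartite_graph (induced_subgraph G S)"
  then obtain X Y where XY: "X \<noteq> {}" "Y \<noteq> {}" "X \<inter> Y = {}" "S = X \<union> Y"
    and E: "{e \<in> edges G. e \<subseteq> S} = {{x, y} | x y. x \<in> X \<and> y \<in> Y}"
    unfolding complete_bipartite_graph_def induced_subgraph_def by auto
  have "{x, y} \<in> edges G \<longleftrightarrow> (x \<in> X) \<noteq> (y \<in> X)" if "x \<in> S" "y \<in> S" for x y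
  proof -
    have "{x, y} \<in> edges G \<longleftrightarrow> {x, y} \<in> {{x, y} | x y. x \<in> X \<and> y \<in> Y}"
      using that E by blast
    also have "\<dots> \<longleftrightarrow> (x \<in> X) \<noteq> (y \<in> X)"
      using that XY by (auto simp: doubleton_eq_iff)
    finally show ?thesis .
  qed
  then have "splits G X S"
    by (simp add: splits_def)
  moreover have "\<exists>e\<in>edges G. e \<subseteq> S"
    using XY E by blast
  ultimately show "(\<exists>X. splits G X S) \<and> (\<exists>e\<in>edges G. e \<subseteq> S)"
    by blast
next
  assume "(\<exists>X. splits G X S) \<and> (\<exists>e\<in>edges G. e \<subseteq> S)"
  then obtain X e where X: "splits G X S" and e: "e \<in> edges G" "e \<subseteq> S"
    by blast
  have LR: "{e \<in> edges G. e \<subseteq> S} = {{x, y} | x y. x \<in> S \<inter> X \<and> y \<in> S - X}" (is "?L = ?R")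
  proof
    show "?L \<subseteq> ?R"
    proof
      fix d assume d: "d \<in> ?L"
      then obtain x y where "d = {x, y}"
        using simple_edgeE[OF G] by blast
      with d splitsD[OF X, of x y] show "d \<in> ?R"
        by (cases "x \<in> X") (auto simp: doubleton_eq_iff)
    qed
    show "?R \<subseteq> ?L"
      using splitsD[OF X] by auto
  qed
  have "e \<in> ?R"
    using e unfolding LR[symmetric] by simp
  then have "S \<inter> X \<noteq> {}" "S - X \<noteq> {}"
    by auto
  then show "complete_bipartite_graph (induced_subgraph G S)"
    unfolding complete_bipartite_graph_def induced_subgraph_def
    using LR by (intro exI[of _ "S \<inter> X"] exI[of _ "S - X"]) auto
qed

text \<open>Among the finitely many complete bipartite vertex sets containing \<open>S\<close> there
  is a maximal one. This reduces finding a biclique to finding a bipartition.\<close>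

lemma biclique_superset:
  assumes "finite_simple_graph G" "S \<subseteq> verts G" "splits G X S" "e \<in> edges G" "e \<subseteq> S"
  obtains B where "is_biclique G B" "S \<subseteq> B"
proof -
  have cb: "complete_bipartite_graph (induced_subgraph G S)"
    using assms complete_bipartite_induced_iff by blast
  have fin: "finite (verts G)"
    using assms(1) by (simp add: finite_simple_graph_def)
  obtain B where "S \<subseteq> B" "B \<subseteq> verts G" "complete_bipartite_graph (induced_subgraph G B)"
    "\<forall>B'. B \<subseteq> B' \<and> B' \<subseteq> verts G \<and> complete_bipartite_graph (induced_subgraph G B') \<longrightarrow> B' = B"
    by (rule finite_maximal_superset[where P = "\<lambda>B. complete_bipartite_graph (induced_subgraph G B)",
          OF fin assms(2) cb])
  then show thesis
    by (intro that[of B]) (auto simp: is_biclique_def)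
qed

lemma bicliqueE:
  assumes "finite_simple_graph G" "is_biclique G B"
  obtains X e where "splits G X B" "e \<in> edges G" "e \<subseteq> B"
proof -
  have "complete_bipartite_graph (induced_subgraph G B)"
    using assms(2) unfolding is_biclique_def by (elim conjE)
  then show thesis
    unfolding complete_bipartite_induced_iff[OF assms(1)] using that by blast
qed

section \<open>Adjacency and complete sets in the biclique line graph\<close>

lemma complete_induced_iff:
  assumes "\<And>e. e \<in> edges H \<Longrightarrow> card e = 2"
  shows "complete_graph (induced_subgraph H C) \<longleftrightarrow>
    C \<noteq> {} \<and> (\<forall>x\<in>C. \<forall>y\<in>C. x \<noteq> y \<longrightarrow> {x, y} \<in> edges H)"
  using assms unfolding complete_graph_def induced_subgraph_def
  by (auto simp: card_2_iff)

text \<open>The bipartition of a common biclique restricts to the endpoints of both edges;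
  conversely, a split union of two edges contains an edge and therefore extends to a
  biclique.\<close>

lemma line_graph_edge_iff:
  assumes G: "finite_simple_graph G" and "e \<in> edges G" "f \<in> edges G" "e \<noteq> f"
  shows "{e, f} \<in> edges (biclique_line_graph G) \<longleftrightarrow> (\<exists>X. splits G X (e \<union> f))"
proof -
  have "{e, f} \<in> edges (biclique_line_graph G) \<longleftrightarrow> (\<exists>B. is_biclique G B \<and> e \<union> f \<subseteq> B)"
    using assms by (auto simp: biclique_line_graph_def induced_subgraph_def doubleton_eq_iff)
  also have "\<dots> \<longleftrightarrow> (\<exists>X. splits G X (e \<union> f))"
  proof
    assume "\<exists>B. is_biclique G B \<and> e \<union> f \<subseteq> B"
    then show "\<exists>X. splits G X (e \<union> f)"
      using bicliqueE[OF G] splits_subset by metis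
  next
    assume "\<exists>X. splits G X (e \<union> f)"
    moreover have "e \<union> f \<subseteq> verts G"
      using assms by (auto simp: finite_simple_graph_def)
    ultimately show "\<exists>B. is_biclique G B \<and> e \<union> f \<subseteq> B"
      using biclique_superset[OF G] assms(2) by (metis Un_upper1)
  qed
  finally show ?thesis .
qed

text \<open>The pairs \<open>e = f\<close> can be included because the two ends of a single edge
  always split. Later arguments then need no distinctness assumption.\<close>

lemma complete_line_graph_iff:
  assumes G: "finite_simple_graph G" and C: "C \<subseteq> edges G"
  shows "complete_graph (induced_subgraph (biclique_line_graph G) C) \<longleftrightarrow>
    C \<noteq> {} \<and> (\<forall>e\<in>C. \<forall>f\<in>C. \<exists>X. splits G X (e \<union> f))"
proof -
  have "card d = 2" if "d \<in> edges (biclique_line_graph G)" for d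
    using that by (clarsimp simp: biclique_line_graph_def)
  then have "complete_graph (induced_subgraph (biclique_line_graph G) C) \<longleftrightarrow>
      C \<noteq> {} \<and> (\<forall>e\<in>C. \<forall>f\<in>C. e \<noteq> f \<longrightarrow> {e, f} \<in> edges (biclique_line_graph G))"
    by (rule complete_induced_iff)
  also have "\<dots> \<longleftrightarrow> C \<noteq> {} \<and> (\<forall>e\<in>C. \<forall>f\<in>C. e \<noteq> f \<longrightarrow> (\<exists>X. splits G X (e \<union> f)))"
    using line_graph_edge_iff[OF G] C by (metis subsetD)
  also have "\<dots> \<longleftrightarrow> C \<noteq> {} \<and> (\<forall>e\<in>C. \<forall>f\<in>C. \<exists>X. splits G X (e \<union> f))"
  proof -
    have "\<exists>X. splits G X (e \<union> e)" if "e \<in> C" for e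
      using that C edge_splits[OF G] simple_edgeE[OF G] by (metis Un_absorb subsetD)
    then show ?thesis
      by metis
  qed
  finally show ?thesis .
qed

section \<open>Induced prisms expressed through adjacencies\<close>

text \<open>The bijection is inverted to start from \<open>H\<close>, so that for a concrete
  \<open>H\<close> such as the prism all adjacencies can be checked by enumeration.\<close>

lemma isomorphic_induced_iff:
  assumes G: "finite_simple_graph G" and H: "finite_simple_graph H"
  shows "graph_isomorphic (induced_subgraph G S) H \<longleftrightarrow>
    (\<exists>g. bij_betw g (verts H) S \<and>
      (\<forall>i\<in>verts H. \<forall>j\<in>verts H. {g i, g j} \<in> edges G \<longleftrightarrow> {i, j} \<in> edges H))"
proof
  assume "graph_isomorphic (induced_subgraph G S) H"
  then obtain f where f: "bij_betw f S (verts H)"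
    and E: "edges H = (\<lambda>e. f ` e) ` {e \<in> edges G. e \<subseteq> S}"
    by (auto simp: graph_isomorphic_def induced_subgraph_def)
  define g where "g = inv_into S f"
  have g: "bij_betw g (verts H) S"
    unfolding g_def using f by (rule bij_betw_inv_into)
  have "{g i, g j} \<in> edges G \<longleftrightarrow> {i, j} \<in> edges H" if ij: "i \<in> verts H" "j \<in> verts H" for i j
  proof -
    have S: "{g i, g j} \<subseteq> S" and fg: "f ` {g i, g j} = {i, j}"
      using ij f g by (auto simp: bij_betw_def g_def f_inv_into_f)
    \<comment> \<open>By injectivity, \<open>{g i, g j}\<close> is the only subset of
      \<open>S\<close> with image \<open>{i, j}\<close>, so an edge of \<open>H\<close> cannot come
      from any other edge of \<open>G\<close>.\<close>
    have "e = {g i, g j}" if "e \<subseteq> S" "f ` e = {i, j}" for e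
      using that S fg f by (metis bij_betw_def inj_on_image_eq_iff)
    then show ?thesis
      unfolding E using S fg by (auto simp: image_iff)
  qed
  with g show "\<exists>g. bij_betw g (verts H) S \<and>
      (\<forall>i\<in>verts H. \<forall>j\<in>verts H. {g i, g j} \<in> edges G \<longleftrightarrow> {i, j} \<in> edges H)"
    by blast
next
  assume "\<exists>g. bij_betw g (verts H) S \<and>
      (\<forall>i\<in>verts H. \<forall>j\<in>verts H. {g i, g j} \<in> edges G \<longleftrightarrow> {i, j} \<in> edges H)"
  then obtain g where g: "bij_betw g (verts H) S"
    and adj: "\<And>i j. i \<in> verts H \<Longrightarrow> j \<in> verts H \<Longrightarrow> {g i, g j} \<in> edges G \<longleftrightarrow> {i, j} \<in> edges H"
    by blast
  define f where "f = inv_into (verts H) g"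
  have f: "bij_betw f S (verts H)"
    unfolding f_def using g by (rule bij_betw_inv_into)
  have gf: "g (f x) = x" "f x \<in> verts H" if "x \<in> S" for x
    using that f g by (auto simp: bij_betw_def f_def f_inv_into_f)
  have fg: "f (g i) = i" "g i \<in> S" if "i \<in> verts H" for i
    using that g by (auto simp: bij_betw_def f_def)
  have "edges H = (\<lambda>e. f ` e) ` {e \<in> edges G. e \<subseteq> S}" (is "_ = ?R")
  proof
    show "edges H \<subseteq> ?R"
    proof
      fix d assume d: "d \<in> edges H"
      then obtain i j where ij: "d = {i, j}" "i \<in> verts H" "j \<in> verts H"
        using simple_edgeE[OF H] by metis
      then have "{g i, g j} \<in> edges G" "{g i, g j} \<subseteq> S" "f ` {g i, g j} = d"
        using d adj fg by auto
      then show "d \<in> ?R"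
        by blast
    qed
    show "?R \<subseteq> edges H"
    proof
      fix d assume "d \<in> ?R"
      then obtain e where e: "e \<in> edges G" "e \<subseteq> S" "d = f ` e"
        by blast
      then obtain x y where xy: "e = {x, y}"
        using simple_edgeE[OF G] by metis
      then show "d \<in> edges H"
        using e adj[of "f x" "f y"] gf by auto
    qed
  qed
  with f show "graph_isomorphic (induced_subgraph G S) H"
    by (auto simp: graph_isomorphic_def induced_subgraph_def)
qed

lemma finite_simple_triangular_prism: "finite_simple_graph triangular_prism"
  by (simp add: finite_simple_graph_def triangular_prism_def)

text \<open>The triangles are \<open>abc\<close> and \<open>def\<close>, the rungs are \<open>ad\<close>, \<open>be\<close>, \<open>cf\<close>.\<close>

definition induced_prism :: "'a hypergraph \<Rightarrow> 'a \<Rightarrow> 'a \<Rightarrow> 'a \<Rightarrow> 'a \<Rightarrow> 'a \<Rightarrow> 'a \<Rightarrow> bool" where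
  "induced_prism G a b c d e f \<longleftrightarrow>
     {a, b} \<in> edges G \<and> {b, c} \<in> edges G \<and> {a, c} \<in> edges G \<and>
     {d, e} \<in> edges G \<and> {e, f} \<in> edges G \<and> {d, f} \<in> edges G \<and>
     {a, d} \<in> edges G \<and> {b, e} \<in> edges G \<and> {c, f} \<in> edges G \<and>
     {a, e} \<notin> edges G \<and> {a, f} \<notin> edges G \<and> {b, d} \<notin> edges G \<and>
     {b, f} \<notin> edges G \<and> {c, d} \<notin> edges G \<and> {c, e} \<notin> edges G"

text \<open>The fifteen adjacency conditions already force six distinct vertices: adjacent ones
  differ since there are no loops, and nonadjacent ones differ since some third vertex is adjacent
  to only one of them.\<close>

lemma contains_prism_iff:
  assumes G: "finite_simple_graph G"
  shows "(\<exists>S. S \<subseteq> verts G \<and> graph_isomorphic (induced_subgraph G S) triangular_prism) \<longleftrightarrow>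
    (\<exists>a b c d e f. induced_prism G a b c d e f)"
proof
  assume "\<exists>S. S \<subseteq> verts G \<and> graph_isomorphic (induced_subgraph G S) triangular_prism"
  then obtain g where "\<forall>i\<in>verts triangular_prism. \<forall>j\<in>verts triangular_prism.
      {g i, g j} \<in> edges G \<longleftrightarrow> {i, j} \<in> edges triangular_prism"
    unfolding isomorphic_induced_iff[OF G finite_simple_triangular_prism] by blast
  then have "induced_prism G (g 0) (g 1) (g 2) (g 3) (g 4) (g 5)"
    unfolding induced_prism_def by (simp add: triangular_prism_def doubleton_eq_iff)
  then show "\<exists>a b c d e f. induced_prism G a b c d e f"
    by blast
next
  assume "\<exists>a b c d e f. induced_prism G a b c d e f"
  then obtain a b c d e f where P: "induced_prism G a b c d e f"
    by blast
  \<comment> \<open>Indexing this list gives the bijection from the vertices of the prism; its order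
    matches their numbering, with rungs joining \<open>i\<close> and \<open>i + 3\<close>.\<close>
  define xs where "xs = [a, b, c, d, e, f]"
  have "distinct xs"
    using P simple_no_loop[OF G] unfolding xs_def induced_prism_def
    by (auto simp: insert_commute)
  moreover have V: "verts triangular_prism = {..<length xs}"
    by (auto simp: xs_def triangular_prism_def)
  ultimately have "bij_betw (nth xs) (verts triangular_prism) (set xs)"
    using bij_betw_nth by blast
  moreover have "\<forall>i\<in>verts triangular_prism. \<forall>j\<in>verts triangular_prism.
      {xs ! i, xs ! j} \<in> edges G \<longleftrightarrow> {i, j} \<in> edges triangular_prism"
    using P simple_no_loop[OF G] unfolding induced_prism_def
    by (simp add: xs_def triangular_prism_def doubleton_eq_iff insert_commute)
  moreover have "set xs \<subseteq> verts G"
    using P G unfolding xs_def induced_prism_def finite_simple_graph_def by auto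
  ultimately show "\<exists>S. S \<subseteq> verts G \<and> graph_isomorphic (induced_subgraph G S) triangular_prism"
    unfolding isomorphic_induced_iff[OF G finite_simple_triangular_prism] by blast
qed

section \<open>Bipartition of the vertices covered by a complete set of edges\<close>

lemma splits_Union_if_prism_free:
  assumes G: "finite_simple_graph G"
    and free: "\<nexists>a b c d e f. induced_prism G a b c d e f"
    and C: "C \<subseteq> edges G" "C \<noteq> {}"
    and compat: "\<And>e f. e \<in> C \<Longrightarrow> f \<in> C \<Longrightarrow> \<exists>X. splits G X (e \<union> f)"
  shows "\<exists>X. splits G X (\<Union>C)"
proof -
  obtain u v where uv: "{u, v} \<in> C"
    using C simple_edgeE[OF G] by (metis ex_in_conv subsetD)
  \<comment> \<open>The side of \<open>u\<close>, consisting of the neighbours of \<open>v\<close>.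
    By \<open>one\<close>, the covered vertices outside it are neighbours of
    \<open>u\<close>.\<close>
  define X where "X = {w. {v, w} \<in> edges G}"
  \<comment> \<open>\<open>u\<close> and \<open>v\<close> lie on different sides of the bipartition
    for \<open>uv\<close> and an edge through \<open>w\<close>, so exactly one of them is opposite
    \<open>w\<close>.\<close>
  have one: "{u, w} \<in> edges G \<longleftrightarrow> {v, w} \<notin> edges G" if w: "w \<in> \<Union>C" for w
  proof -
    obtain f where "f \<in> C" "w \<in> f"
      using w by blast
    with compat[OF uv] obtain Z where Z: "splits G Z ({u, v} \<union> f)"
      by blast
    have "{u, v} \<in> edges G"
      using uv C by blast
    then show ?thesis
      using splitsD[OF Z, of u v] splitsD[OF Z, of u w] splitsD[OF Z, of v w] \<open>w \<in> f\<close> by auto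
  qed
  \<comment> \<open>In the bipartition for \<open>uv\<close> and \<open>wp\<close>, exactly one of
    \<open>w\<close> and \<open>p\<close> is opposite \<open>v\<close>.\<close>
  have cross: "w \<in> X \<longleftrightarrow> p \<notin> X" if wp: "{w, p} \<in> C" for w p
  proof -
    obtain Z where Z: "splits G Z ({u, v} \<union> {w, p})"
      using compat[OF uv wp] by blast
    have "{w, p} \<in> edges G"
      using wp C by blast
    then show ?thesis
      using splitsD[OF Z, of w p] splitsD[OF Z, of v w] splitsD[OF Z, of v p]
      by (auto simp: X_def)
  qed
  have key: "{w, w'} \<notin> edges G \<and> {w, p'} \<in> edges G"
    if wp: "{w, p} \<in> C" "{w', p'} \<in> C" and X: "w \<in> X \<longleftrightarrow> w' \<in> X" for w p w' p'
  proof -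
    have E: "{u, v} \<in> edges G" "{w, p} \<in> edges G" "{w', p'} \<in> edges G"
      using uv wp C by auto
    obtain Z where Z: "splits G Z ({w, p} \<union> {w', p'})"
      using compat[OF wp] by blast
    have "{w, w'} \<notin> edges G"
    proof
      assume ww: "{w, w'} \<in> edges G"
      \<comment> \<open>With \<open>w\<close> and \<open>w'\<close> on opposite sides of
        \<open>Z\<close>, \<open>p\<close> joins the side of \<open>w'\<close> and \<open>p'\<close>
        that of \<open>w\<close>: the two edges span an induced 4-cycle.\<close>
      have Zs: "(w \<in> Z) \<noteq> (p \<in> Z)" "(w' \<in> Z) \<noteq> (p' \<in> Z)" "(w \<in> Z) \<noteq> (w' \<in> Z)"
        using splitsD[OF Z, of w p] splitsD[OF Z, of w' p'] splitsD[OF Z, of w w'] E ww by auto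
      then have pp: "{p, p'} \<in> edges G" "{w, p'} \<notin> edges G" "{w', p} \<notin> edges G"
        using splitsD[OF Z, of p p'] splitsD[OF Z, of w p'] splitsD[OF Z, of w' p] by auto
      have cov: "w \<in> \<Union>C" "w' \<in> \<Union>C" "p \<in> \<Union>C" "p' \<in> \<Union>C"
        using wp by auto
      note facts = E ww pp one[OF cov(1)] one[OF cov(2)] one[OF cov(3)] one[OF cov(4)]
        cross[OF wp(1)] cross[OF wp(2)] X
      \<comment> \<open>The triangle at \<open>v\<close> uses the ends lying in \<open>X\<close>,
        and the triangle at \<open>u\<close> uses the other two; these are \<open>w\<close>,
        \<open>w'\<close> and \<open>p\<close>, \<open>p'\<close> in one order or the other.\<close>
      have "induced_prism G v w w' u p p' \<or> induced_prism G v p p' u w w'"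
        using facts unfolding induced_prism_def X_def
        by (cases "w \<in> X") (simp_all add: X_def insert_commute)
      with free show False
        by blast
    qed
    then show ?thesis
      using splitsD[OF Z, of w w'] splitsD[OF Z, of w p'] splitsD[OF Z, of w' p'] E by auto
  qed
  have adj: "{w, w'} \<in> edges G \<longleftrightarrow> (w \<in> X) \<noteq> (w' \<in> X)" if W: "w \<in> \<Union>C" "w' \<in> \<Union>C" for w w'
  proof -
    have "\<exists>p. {z, p} \<in> C" if z: "z \<in> \<Union>C" for z
    proof -
      obtain e where e: "e \<in> C" "z \<in> e"
        using z by blast
      then obtain x y where "e = {x, y}"
        using C simple_edgeE[OF G] by (metis subsetD)
      with e show ?thesis
        by (auto simp: insert_commute)
    qed
    with W obtain p p' where wp: "{w, p} \<in> C" and wp': "{w', p'} \<in> C"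
      by blast
    \<comment> \<open>If \<open>w\<close> and \<open>w'\<close> are on the same side,
      \<open>key\<close> for \<open>wp\<close> and \<open>w'p'\<close> excludes the edge
      \<open>ww'\<close>. Otherwise \<open>p'\<close> is on the side of \<open>w\<close>, and
      \<open>key\<close> with the second edge reversed yields it.\<close>
    from wp' have pw': "{p', w'} \<in> C"
      by (simp add: insert_commute)
    show ?thesis
      using key[OF wp wp'] key[OF wp pw'] cross[OF wp'] by blast
  qed
  show ?thesis
    unfolding splits_def by (intro exI[of _ X] ballI adj)
qed

section \<open>Edge sets of bicliques as complete sets of the line graph\<close>

lemma biclique_edges_complete:
  assumes G: "finite_simple_graph G" and B: "is_biclique G B"
  shows "complete_graph (induced_subgraph (biclique_line_graph G) {e \<in> edges G. e \<subseteq> B})"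
proof -
  obtain X e where X: "splits G X B" and e: "e \<in> edges G" "e \<subseteq> B"
    using bicliqueE[OF G B] .
  have "\<exists>Y. splits G Y (d \<union> d')" if "d \<subseteq> B" "d' \<subseteq> B" for d d'
    using splits_subset[OF X] that by (meson Un_least)
  moreover have "{e \<in> edges G. e \<subseteq> B} \<subseteq> edges G" "{e \<in> edges G. e \<subseteq> B} \<noteq> {}"
    using e by auto
  ultimately show ?thesis
    by (subst complete_line_graph_iff[OF G]) simp_all
qed

text \<open>Every vertex of \<open>B\<close> is opposite one end of any fixed edge inside
  \<open>B\<close>. Hence a biclique can be recovered from its edge set, and inclusions of edge sets
  become inclusions of bicliques.\<close>

lemma Union_biclique_edges:
  assumes G: "finite_simple_graph G" and B: "is_biclique G B"
  shows "\<Union>{e \<in> edges G. e \<subseteq> B} = B"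
proof -
  obtain X e where X: "splits G X B" and e: "e \<in> edges G" "e \<subseteq> B"
    using bicliqueE[OF G B] .
  obtain x y where xy: "e = {x, y}"
    using simple_edgeE[OF G e(1)] by blast
  have "z \<in> \<Union>{e \<in> edges G. e \<subseteq> B}" if z: "z \<in> B" for z
  proof -
    have "{z, x} \<in> edges G \<or> {z, y} \<in> edges G"
      using splitsD[OF X, of z x] splitsD[OF X, of z y] splitsD[OF X, of x y] e xy z by auto
    then show ?thesis
      using e xy z by auto
  qed
  then show ?thesis
    by blast
qed

lemma complete_line_graph_subset_biclique:
  assumes G: "finite_simple_graph G"
    and free: "\<nexists>a b c d e f. induced_prism G a b c d e f"
    and C: "C \<subseteq> edges G" "complete_graph (induced_subgraph (biclique_line_graph G) C)"
  obtains B where "is_biclique G B" "C \<subseteq> {e \<in> edges G. e \<subseteq> B}"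
proof -
  have ne: "C \<noteq> {}" and compat: "\<forall>e\<in>C. \<forall>f\<in>C. \<exists>X. splits G X (e \<union> f)"
    using C(2) unfolding complete_line_graph_iff[OF G C(1)] by blast+
  obtain X where X: "splits G X (\<Union>C)"
    using splits_Union_if_prism_free[OF G free C(1) ne] compat by blast
  moreover have "\<Union>C \<subseteq> verts G"
    using C(1) G by (auto simp: finite_simple_graph_def)
  moreover obtain e where "e \<in> C"
    using ne by blast
  ultimately obtain B where "is_biclique G B" "\<Union>C \<subseteq> B"
    using biclique_superset[OF G] C(1) by (metis Union_upper subsetD)
  then show thesis
    using that C(1) by blast
qed

lemma verts_biclique_line_graph: "verts (biclique_line_graph G) = edges G"
  by (simp add: biclique_line_graph_def)

section \<open>Equality of the two hypergraphs\<close>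

lemma hypergraphs_eq_iff:
  fixes G :: "'a hypergraph"
  shows "edge_biclique_hypergraph G = clique_hypergraph (biclique_line_graph G) \<longleftrightarrow>
    (\<forall>C. is_clique (biclique_line_graph G) C \<longleftrightarrow>
      (\<exists>B. is_biclique G B \<and> C = {e \<in> edges G. e \<subseteq> B}))"
proof -
  have Collect_eq: "{C. P C} = {C. Q C} \<longleftrightarrow> (\<forall>C. Q C \<longleftrightarrow> P C)" for P Q :: "'a set set \<Rightarrow> bool"
    by auto
  have "edge_biclique_hypergraph G = clique_hypergraph (biclique_line_graph G) \<longleftrightarrow>
      {C. \<exists>B. C = {e \<in> edges G. e \<subseteq> B} \<and> is_biclique G B} = {C. is_clique (biclique_line_graph G) C}"
    by (simp add: edge_biclique_hypergraph_def clique_hypergraph_def verts_biclique_line_graph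
        induced_subgraph_def)
  also have "\<dots> \<longleftrightarrow> (\<forall>C. is_clique (biclique_line_graph G) C \<longleftrightarrow>
      (\<exists>B. is_biclique G B \<and> C = {e \<in> edges G. e \<subseteq> B}))"
    unfolding Collect_eq by (simp only: conj_commute)
  finally show ?thesis .
qed

text \<open>Biclique edge sets are complete, and every complete set lies in one of them. So a clique
  equals the edge set containing it, by its own maximality; and a complete set containing the edges
  of \<open>B\<close> lies in a biclique that is \<open>B\<close> itself, by maximality of
  \<open>B\<close>.\<close>

lemma prism_free_imp_eq:
  assumes G: "finite_simple_graph G"
    and free: "\<nexists>a b c d e f. induced_prism G a b c d e f"
  shows "edge_biclique_hypergraph G = clique_hypergraph (biclique_line_graph G)"
  unfolding hypergraphs_eq_iff
proof (intro allI iffI)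
  fix C assume "is_clique (biclique_line_graph G) C"
  then have C: "C \<subseteq> edges G" "complete_graph (induced_subgraph (biclique_line_graph G) C)"
    and max: "\<And>C'. C \<subseteq> C' \<Longrightarrow> C' \<subseteq> edges G \<Longrightarrow>
      complete_graph (induced_subgraph (biclique_line_graph G) C') \<Longrightarrow> C' = C"
    unfolding is_clique_def verts_biclique_line_graph by blast+
  obtain B where B: "is_biclique G B" "C \<subseteq> {e \<in> edges G. e \<subseteq> B}"
    using complete_line_graph_subset_biclique[OF G free C] .
  have "{e \<in> edges G. e \<subseteq> B} = C"
    using B biclique_edges_complete[OF G B(1)] by (intro max) auto
  with B show "\<exists>B. is_biclique G B \<and> C = {e \<in> edges G. e \<subseteq> B}"
    by blast
next
  fix C assume "\<exists>B. is_biclique G B \<and> C = {e \<in> edges G. e \<subseteq> B}"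
  then obtain B where B: "is_biclique G B" and C: "C = {e \<in> edges G. e \<subseteq> B}"
    by blast
  have "C' = C" if C': "C \<subseteq> C'" "C' \<subseteq> edges G"
    "complete_graph (induced_subgraph (biclique_line_graph G) C')" for C'
  proof -
    obtain B' where B': "is_biclique G B'" "C' \<subseteq> {e \<in> edges G. e \<subseteq> B'}"
      using complete_line_graph_subset_biclique[OF G free C'(2,3)] .
    have "B \<subseteq> B'"
      using Union_biclique_edges[OF G B] C C'(1) B'(2) by blast
    then have "B' = B"
      using B B'(1) unfolding is_biclique_def by blast
    with C C'(1) B'(2) show ?thesis
      by blast
  qed
  moreover have "complete_graph (induced_subgraph (biclique_line_graph G) C)"
    unfolding C using biclique_edges_complete[OF G B] .
  ultimately show "is_clique (biclique_line_graph G) C"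
    unfolding is_clique_def verts_biclique_line_graph using C by blast
qed

lemma prism_imp_neq:
  assumes G: "finite_simple_graph G" and P: "induced_prism G a b c d e f"
  shows "edge_biclique_hypergraph G \<noteq> clique_hypergraph (biclique_line_graph G)"
proof
  assume eq: "edge_biclique_hypergraph G = clique_hypergraph (biclique_line_graph G)"
  define R where "R = {{a, d}, {b, e}, {c, f}}"
  have R: "R \<subseteq> edges G"
    using P by (auto simp: R_def induced_prism_def)
  \<comment> \<open>Two rungs span an induced 4-cycle, whose sides are the pairs of opposite
    corners.\<close>
  have rungs: "splits G {x, y'} ({x, x'} \<union> {y, y'})"
    if "{x, y} \<in> edges G" "{x', y'} \<in> edges G" "{x, x'} \<in> edges G" "{y, y'} \<in> edges G"
      "{x, y'} \<notin> edges G" "{y, x'} \<notin> edges G" for x y x' y'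
    using that simple_no_loop[OF G] by (auto simp: splits_def insert_commute)
  have "splits G {a, e} ({a, d} \<union> {b, e})" "splits G {a, f} ({a, d} \<union> {c, f})"
    "splits G {b, f} ({b, e} \<union> {c, f})" "splits G {a} ({a, d} \<union> {a, d})"
    "splits G {b} ({b, e} \<union> {b, e})" "splits G {c} ({c, f} \<union> {c, f})"
    using P unfolding induced_prism_def Un_absorb by (blast intro: rungs edge_splits[OF G])+
  then have "\<forall>x\<in>R. \<forall>y\<in>R. \<exists>X. splits G X (x \<union> y)"
    unfolding R_def ball_simps by (metis Un_commute)
  then have cR: "complete_graph (induced_subgraph (biclique_line_graph G) R)"
    unfolding complete_line_graph_iff[OF G R] by (simp add: R_def)
  have fin: "finite (edges G)"
    using G unfolding finite_simple_graph_def
    by (meson Pow_iff finite_Pow_iff finite_subset subsetI)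
  obtain C where C: "R \<subseteq> C" "C \<subseteq> edges G"
    "complete_graph (induced_subgraph (biclique_line_graph G) C)"
    "\<forall>C'. C \<subseteq> C' \<and> C' \<subseteq> edges G \<and> complete_graph (induced_subgraph (biclique_line_graph G) C')
      \<longrightarrow> C' = C"
    by (rule finite_maximal_superset[where P =
          "\<lambda>C. complete_graph (induced_subgraph (biclique_line_graph G) C)", OF fin R cR])
  then have "is_clique (biclique_line_graph G) C"
    unfolding is_clique_def verts_biclique_line_graph by blast
  with eq obtain B where B: "is_biclique G B" "C = {e \<in> edges G. e \<subseteq> B}"
    unfolding hypergraphs_eq_iff by blast
  then obtain X where X: "splits G X B"
    using bicliqueE[OF G] by metis
  \<comment> \<open>Any biclique containing the rungs contains the triangle \<open>abc\<close>; two
    of its three corners would share a side although they are adjacent.\<close>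
  have "a \<in> B" "b \<in> B" "c \<in> B"
    using C(1) B(2) by (auto simp: R_def)
  then show False
    using P splitsD[OF X, of a b] splitsD[OF X, of b c] splitsD[OF X, of a c]
    unfolding induced_prism_def by blast
qed

theorem theorem5:
  fixes G :: "'a hypergraph"
  assumes "finite_simple_graph G"
  shows "edge_biclique_hypergraph G = clique_hypergraph (biclique_line_graph G) \<longleftrightarrow>
    \<not> (\<exists>S. S \<subseteq> verts G \<and> graph_isomorphic (induced_subgraph G S) triangular_prism)"
  unfolding contains_prism_iff[OF assms]
  using prism_free_imp_eq[OF assms] prism_imp_neq[OF assms] by blast

end
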